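(* Let $k_1,k_2,k_3$ and $\epsilon\neq0$ be real constants. The solutions (near $s=0$) of the equation $$s(k_2-k_3s^2)(\phi\phi'-s\phi'^2-s\phi\phi'')-(\phi'^2+\phi\phi'')+k_1\phi(\phi-s\phi')=0$$ with the initial conditions $\phi(0)=1$, $\phi'(0)=\epsilon$ are given by $$\phi(s)=\sqrt{(1+k_1s^2)\left\{1+2\epsilon\int_0^s(1+k_1\sigma^2)^{-\frac32}f\!\left(\frac{\sigma}{\sqrt{1+k_1\sigma^2}}\right)d\sigma\right\}},$$ where $f$ is the function determined by $k_1,k_2,k_3$ as specified in the context.
   Context: Put $\Delta_1=k_2^2+4k_3$, $\Delta_2=k_2-2k_1$, $\Delta_3=k_1^2-k_1k_2-k_3$ (these satisfy $\Delta_2^2-4\Delta_3=\Delta_1$). The function $f(s)$, with $f(0)=1$, is defined near $s=0$ by: 1. when $\Delta_3=0$, $\Delta_1=0$: $f(s)=1$; 2. when $\Delta_3=0$, $\Delta_1\neq0$: $f(s)=\sqrt{1+\Delta_2s^2}$; 3. when $\Delta_3\neq0$, $\Delta_1>0$: $$f(s)=\sqrt[4]{1+\Delta_2s^2+\Delta_3s^4}\left\{\frac{2+(\Delta_2+\sqrt{\Delta_1})s^2}{2+(\Delta_2-\sqrt{\Delta_1})s^2}\right\}^{\frac{\Delta_2}{4\sqrt{\Delta_1}}};$$ 4. when $\Delta_3\neq0$, $\Delta_1=0$: $$f(s)=\sqrt{1+\tfrac{\Delta_2}{2}s^2}\,\exp\left\{\frac12-\frac{1}{2+\Delta_2s^2}\right\};$$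 5. when $\Delta_3\neq0$, $\Delta_1<0$: $$f(s)=\sqrt[4]{1+\Delta_2s^2+\Delta_3s^4}\,\exp\left\{\frac{\Delta_2}{2\sqrt{-\Delta_1}}\left[\arctan\frac{\Delta_2+2\Delta_3s^2}{\sqrt{-\Delta_1}}-\arctan\frac{\Delta_2}{\sqrt{-\Delta_1}}\right]\right\}.$$ Solutions are positive smooth functions $\phi$ on an open interval around $s=0$. *)

theory Defs
  imports "HOL-Analysis.Analysis"
begin

definition Delta1 :: "real \<Rightarrow> real \<Rightarrow> real \<Rightarrow> real" where
  "Delta1 k1 k2 k3 = k2\<^sup>2 + 4 * k3"

definition Delta2 :: "real \<Rightarrow> real \<Rightarrow> real \<Rightarrow> real" where
  "Delta2 k1 k2 k3 = k2 - 2 * k1"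

definition Delta3 :: "real \<Rightarrow> real \<Rightarrow> real \<Rightarrow> real" where
  "Delta3 k1 k2 k3 = k1\<^sup>2 - k1 * k2 - k3"

lemma Delta_relation:
  "(Delta2 k1 k2 k3)\<^sup>2 - 4 * Delta3 k1 k2 k3 = Delta1 k1 k2 k3"
  by (simp add: Delta1_def Delta2_def Delta3_def power2_eq_square algebra_simps)

(* Only the values for s near 0 are meaningful: there all radicands, bases of powers and
   denominators are positive. *)
definition f_fun :: "real \<Rightarrow> real \<Rightarrow> real \<Rightarrow> real \<Rightarrow> real" where
  "f_fun k1 k2 k3 s =
     (let D1 = Delta1 k1 k2 k3; D2 = Delta2 k1 k2 k3; D3 = Delta3 k1 k2 k3 in
      if D3 = 0 then
        (if D1 = 0 then 1 else sqrt (1 + D2 * s\<^sup>2))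
      else if D1 > 0 then
        root 4 (1 + D2 * s\<^sup>2 + D3 * s ^ 4) *
        ((2 + (D2 + sqrt D1) * s\<^sup>2) / (2 + (D2 - sqrt D1) * s\<^sup>2)) powr (D2 / (4 * sqrt D1))
      else if D1 = 0 then
        sqrt (1 + D2 / 2 * s\<^sup>2) * exp (1 / 2 - 1 / (2 + D2 * s\<^sup>2))
      else
        root 4 (1 + D2 * s\<^sup>2 + D3 * s ^ 4) *
        exp (D2 / (2 * sqrt (- D1)) *
          (arctan ((D2 + 2 * D3 * s\<^sup>2) / sqrt (- D1)) - arctan (D2 / sqrt (- D1)))))"

lemma f_fun_0: "f_fun k1 k2 k3 0 = 1"
  by (simp add: f_fun_def Let_def)

(* Meant for open A, where the iterated derivatives at points of A depend only on the
   restriction of g to A. *)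
definition smooth_on_open :: "real set \<Rightarrow> (real \<Rightarrow> real) \<Rightarrow> bool" where
  "smooth_on_open A g \<longleftrightarrow> (\<forall>n. \<forall>x\<in>A. (deriv ^^ n) g differentiable (at x))"

definition is_solution ::
  "real \<Rightarrow> real \<Rightarrow> real \<Rightarrow> real \<Rightarrow> real set \<Rightarrow> (real \<Rightarrow> real) \<Rightarrow> bool" where
  "is_solution k1 k2 k3 \<epsilon> I \<phi> \<longleftrightarrow>
     open I \<and> is_interval I \<and> 0 \<in> I \<and>
     smooth_on_open I \<phi> \<and> (\<forall>s\<in>I. \<phi> s > 0) \<and>
     (\<forall>s\<in>I. s * (k2 - k3 * s\<^sup>2) *
               (\<phi> s * deriv \<phi> s - s * (deriv \<phi> s)\<^sup>2 - s * \<phi> s * deriv (deriv \<phi>) s)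
             - ((deriv \<phi> s)\<^sup>2 + \<phi> s * deriv (deriv \<phi>) s)
             + k1 * \<phi> s * (\<phi> s - s * deriv \<phi> s) = 0) \<and>
     \<phi> 0 = 1 \<and> deriv \<phi> 0 = \<epsilon>"

(* The interval integral is oriented, so s < 0 is covered with the usual sign convention. *)
definition phi_formula :: "real \<Rightarrow> real \<Rightarrow> real \<Rightarrow> real \<Rightarrow> real \<Rightarrow> real" where
  "phi_formula k1 k2 k3 \<epsilon> s =
     sqrt ((1 + k1 * s\<^sup>2) *
       (1 + 2 * \<epsilon> *
         (LBINT \<sigma>=0..s. (1 + k1 * \<sigma>\<^sup>2) powr (- (3 / 2)) *
                         f_fun k1 k2 k3 (\<sigma> / sqrt (1 + k1 * \<sigma>\<^sup>2)))))"

end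

theory Submission
  imports Defs
begin

text \<open>
  The equation is linear in \<open>y = \<phi>\<^sup>2\<close>.  Twice its left-hand side is
  \<open>- P y'' + Q y' + 2 k1 y\<close> with \<open>P = 1 + k2 s\<^sup>2 - k3 s^4\<close> and
  \<open>Q = s (k2 - k1 - k3 s\<^sup>2)\<close> (lemma \<open>solution_ode_linearize\<close>), and
  \<open>y0 = 1 + k1 s\<^sup>2\<close> is one solution of this linear equation, because
  \<open>P = y0 + s Q\<close>.  By Abel's identity the Wronskian \<open>W = y0 y' - y0' y\<close> of \<open>y0\<close> with
  any other solution satisfies the first-order equation \<open>W' = (Q/P) W\<close>
  (\<open>solution_wronskian\<close>), and the initial conditions give \<open>W(0) = 2 \<epsilon>\<close>.

  The function \<open>f\<close> enters because it integrates this first-order equation.  In each of its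
  cases \<open>f'/f = t (D2 + D3 t\<^sup>2) / (1 + D2 t\<^sup>2 + D3 t^4)\<close> near \<open>0\<close>
  (\<open>f_fun_log_derivative\<close>), and after the substitution \<open>t = s / sqrt y0\<close>, under which
  \<open>1 + D2 t\<^sup>2 + D3 t^4\<close> becomes \<open>P / y0\<^sup>2\<close>, this says that
  \<open>G = sqrt y0 * f(s / sqrt y0)\<close> solves \<open>G' = (Q/P) G\<close> with \<open>G(0) = 1\<close>
  (\<open>wronskian_factor_ode\<close>).  Hence \<open>W = 2 \<epsilon> G\<close>, so that
  \<open>(y / y0)' = W / y0\<^sup>2 = 2 \<epsilon> y0 powr (-3/2) * f(s / sqrt y0)\<close>, and one integration
  gives the formula.

  Conversely, \<open>y0 V\<close> with \<open>V' = 2 \<epsilon> G / y0\<^sup>2\<close> and \<open>V(0) = 1\<close> solves the linear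
  equation, and its square root solves the original one as long as it stays positive
  (\<open>variation_of_constants_solution\<close>).  Infinite differentiability follows by bootstrapping:
  the equation expresses \<open>\<phi>''\<close> as a polynomial in \<open>s\<close>, \<open>\<phi>\<close>, \<open>\<phi>'\<close>, \<open>1/\<phi>\<close> and
  \<open>1/P\<close>, so these five functions generate an algebra that is closed under differentiation
  (\<open>smooth_solution\<close>).
\<close>

section \<open>The logarithmic derivative of f\<close>

text \<open>
  The next lemmas write derivatives as \<open>u' = u * p\<close>: the function \<open>f\<close> is a product of
  roots, powers and exponentials, and in this form the factors \<open>p\<close> simply add.
\<close>

lemma has_derivative_sqrt_log:
  fixes u :: "real \<Rightarrow> real"
  assumes "(u has_real_derivative u') (at t)" "u t > 0"
  shows "((\<lambda>t. sqrt (u t)) has_real_derivative sqrt (u t) * (u' / (2 * u t))) (at t)"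
  using assms by (auto intro!: derivative_eq_intros simp: field_simps)

lemma has_derivative_root4_log:
  fixes u :: "real \<Rightarrow> real"
  assumes "(u has_real_derivative u') (at t)" "u t > 0"
  shows "((\<lambda>t. root 4 (u t)) has_real_derivative root 4 (u t) * (u' / (4 * u t))) (at t)"
proof -
  have r: "root 4 (u t) ^ 4 = u t" "root 4 (u t) > 0"
    using assms(2) by (simp_all add: real_root_pow_pos2)
  have "((\<lambda>t. root 4 (u t)) has_real_derivative
           inverse (real 4 * root 4 (u t) ^ (4 - Suc 0)) * u') (at t)"
    by (rule DERIV_chain2[OF DERIV_real_root assms(1)]) (use assms(2) in auto)
  also have "inverse (real 4 * root 4 (u t) ^ (4 - Suc 0)) * u'
               = root 4 (u t) * (u' / (4 * root 4 (u t) ^ 4))"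
    using r(2) by (simp add: field_simps power_def numeral_eq_Suc)
  finally show ?thesis by (simp add: r(1))
qed

lemma has_derivative_powr_log:
  fixes u :: "real \<Rightarrow> real"
  assumes "(u has_real_derivative u') (at t)" "u t > 0"
  shows "((\<lambda>t. u t powr a) has_real_derivative u t powr a * (a * u' / u t)) (at t)"
  using assms
  by (auto intro!: derivative_eq_intros simp: field_simps powr_diff)

lemma has_derivative_mult_log:
  fixes u v :: "real \<Rightarrow> real"
  assumes "(u has_real_derivative u t * p) (at t)" "(v has_real_derivative v t * q) (at t)"
  shows "((\<lambda>t. u t * v t) has_real_derivative u t * v t * (p + q)) (at t)"
  by (rule DERIV_cong[OF DERIV_mult[OF assms]]) (simp add: algebra_simps)

lemma eventually_pos_nhds:
  fixes u :: "real \<Rightarrow> real"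
  assumes "isCont u a" "u a > 0"
  shows "\<forall>\<^sub>F t in nhds a. u t > 0"
  using assms order_tendstoD(1)[of u "u a" "nhds a" 0]
  by (simp add: continuous_at tendsto_at_iff_tendsto_nhds)

lemma eventually_nhds_0_interval:
  assumes "\<forall>\<^sub>F s in nhds (0::real). P s"
  obtains \<delta> where "\<delta> > 0" "\<And>s. s \<in> {-\<delta><..<\<delta>} \<Longrightarrow> P s"
  using assms unfolding eventually_nhds_metric by (force simp: dist_real_def)

text \<open>
  In all cases \<open>f\<close> is a solution of one and the same equation \<open>f' = f t (D2 + D3 t\<^sup>2) / D\<close>,
  where \<open>D = 1 + D2 t\<^sup>2 + D3 t^4\<close>; the cases differ only in how \<open>D\<close> factors.  If
  \<open>D3 = 0\<close>, the numerator is \<open>D' / 2\<close> and \<open>f\<close> is the square root of \<open>D\<close>.  Otherwise \<open>D\<close> is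
  a quadratic in \<open>t\<^sup>2\<close> with discriminant \<open>D1\<close>, and the numerator splits as
  \<open>t (D2 / 2 + D3 t\<^sup>2) + D2 t / 2\<close>.  The first part is \<open>D' / 4\<close> and yields the fourth root of
  \<open>D\<close>; the second yields a logarithm, a rational function or an arctangent of \<open>t\<^sup>2\<close>, according
  to the sign of \<open>D1\<close>.
\<close>

lemma f_fun_log_derivative:
  fixes k1 k2 k3 :: real
  defines "D2 \<equiv> Delta2 k1 k2 k3" and "D3 \<equiv> Delta3 k1 k2 k3"
  shows "\<forall>\<^sub>F t in nhds 0. 1 + D2 * t\<^sup>2 + D3 * t ^ 4 > 0 \<and> f_fun k1 k2 k3 t > 0 \<and>
    (f_fun k1 k2 k3 has_real_derivative
       f_fun k1 k2 k3 t * (t * (D2 + D3 * t\<^sup>2) / (1 + D2 * t\<^sup>2 + D3 * t ^ 4))) (at t)"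
proof -
  define D1 where "D1 = Delta1 k1 k2 k3"
  define D where "D t = 1 + D2 * t\<^sup>2 + D3 * t ^ 4" for t
  have rel: "D2\<^sup>2 - 4 * D3 = D1"
    unfolding D1_def D2_def D3_def by (rule Delta_relation)
  have f_eq: "f_fun k1 k2 k3 = (\<lambda>s.
      if D3 = 0 then
        (if D1 = 0 then 1 else sqrt (1 + D2 * s\<^sup>2))
      else if D1 > 0 then
        root 4 (D s) *
        ((2 + (D2 + sqrt D1) * s\<^sup>2) / (2 + (D2 - sqrt D1) * s\<^sup>2)) powr (D2 / (4 * sqrt D1))
      else if D1 = 0 then
        sqrt (1 + D2 / 2 * s\<^sup>2) * exp (1 / 2 - 1 / (2 + D2 * s\<^sup>2))
      else
        root 4 (D s) *
        exp (D2 / (2 * sqrt (- D1)) *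
          (arctan ((D2 + 2 * D3 * s\<^sup>2) / sqrt (- D1)) - arctan (D2 / sqrt (- D1)))))"
    by (simp add: f_fun_def Let_def D1_def D2_def D3_def D_def fun_eq_iff)
  have Dpos: "\<forall>\<^sub>F t in nhds 0. D t > 0"
    unfolding D_def by (rule eventually_pos_nhds) auto
  have Dder: "(D has_real_derivative 2 * D2 * t + 4 * D3 * t ^ 3) (at t)" for t
    unfolding D_def[abs_def] by (auto intro!: derivative_eq_intros)
  have rootder: "((\<lambda>t. root 4 (D t)) has_real_derivative
      root 4 (D t) * ((2 * D2 * t + 4 * D3 * t ^ 3) / (4 * D t))) (at t)" if "D t > 0" for t
    by (rule has_derivative_root4_log[OF Dder that])
  have half: "(2 * D2 * t + 4 * D3 * t ^ 3) / (4 * D t) + D2 * t / (2 * D t)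
      = t * (D2 + D3 * t\<^sup>2) / D t" if "D t > 0" for t
    using that by (simp add: field_simps power2_eq_square power3_eq_cube)
  consider "D3 = 0" "D1 = 0" | "D3 = 0" "D1 \<noteq> 0" | "D3 \<noteq> 0" "D1 > 0"
    | "D3 \<noteq> 0" "D1 = 0" | "D3 \<noteq> 0" "D1 < 0" by linarith
  then have "\<forall>\<^sub>F t in nhds 0. f_fun k1 k2 k3 t > 0 \<and>
    (f_fun k1 k2 k3 has_real_derivative f_fun k1 k2 k3 t * (t * (D2 + D3 * t\<^sup>2) / D t)) (at t)"
  proof cases
    case 1
    then have "f_fun k1 k2 k3 = (\<lambda>_. 1)" "D2 = 0" using rel f_eq by auto
    with 1 show ?thesis by simp
  next
    case 2
    then have f: "f_fun k1 k2 k3 = (\<lambda>s. sqrt (D s))" using f_eq by (auto simp: D_def)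
    show ?thesis using Dpos
    proof eventually_elim
      case (elim t)
      have "(2 * D2 * t + 4 * D3 * t ^ 3) / (2 * D t) = t * (D2 + D3 * t\<^sup>2) / D t"
        using elim 2 by (simp add: field_simps)
      then show ?case
        using has_derivative_sqrt_log[OF Dder elim] elim by (simp add: f)
    qed
  next
    case 3
    define r a b where "r = sqrt D1" and "a = D2 + r" and "b = D2 - r"
    have r: "r > 0" "r\<^sup>2 = D1" using 3 by (auto simp: r_def)
    have f: "f_fun k1 k2 k3 =
      (\<lambda>s. root 4 (D s) * ((2 + a * s\<^sup>2) / (2 + b * s\<^sup>2)) powr (D2 / (4 * r)))"
      using f_eq 3 by (auto simp: r_def a_def b_def)
    have "\<forall>\<^sub>F t in nhds 0. 2 + a * t\<^sup>2 > 0" "\<forall>\<^sub>F t in nhds 0. 2 + b * t\<^sup>2 > 0"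
      by (rule eventually_pos_nhds; simp)+
    with Dpos show ?thesis
    proof eventually_elim
      case (elim t)
      \<comment> \<open>\<open>a\<close> and \<open>b\<close> come from the two linear factors of \<open>D\<close> in \<open>t\<^sup>2\<close>.\<close>
      have ab: "a * b = 4 * D3" "a + b = 2 * D2" "a - b = 2 * r" using r(2) rel
        by (simp_all add: a_def b_def algebra_simps power2_eq_square)
      have "(2 + a * t\<^sup>2) * (2 + b * t\<^sup>2) = 4 + 2 * (a + b) * t\<^sup>2 + (a * b) * t ^ 4"
        by (simp add: algebra_simps power2_eq_square numeral_eq_Suc)
      also have "\<dots> = 4 * D t" unfolding ab D_def by (simp add: algebra_simps)
      finally have fac: "(2 + a * t\<^sup>2) * (2 + b * t\<^sup>2) = 4 * D t" .
      have q: "((\<lambda>s. (2 + a * s\<^sup>2) / (2 + b * s\<^sup>2)) has_real_derivative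
          4 * (a - b) * t / (2 + b * t\<^sup>2)\<^sup>2) (at t)"
        using elim by (auto intro!: derivative_eq_intros simp: field_simps power2_eq_square)
      have quot: "D2 / (4 * r) * (4 * (2 * r) * t / B\<^sup>2) / (A / B) = 2 * D2 * t / (A * B)"
        if "A > 0" "B > 0" for A B
        using r(1) that by (simp add: power2_eq_square mult.commute)
      have "D2 / (4 * r) * (4 * (a - b) * t / (2 + b * t\<^sup>2)\<^sup>2) / ((2 + a * t\<^sup>2) / (2 + b * t\<^sup>2))
         = 2 * D2 * t / ((2 + a * t\<^sup>2) * (2 + b * t\<^sup>2))"
        unfolding ab by (rule quot) (use elim in auto)
      also have "\<dots> = D2 * t / (2 * D t)" unfolding fac by simp
      finally have e: "D2 / (4 * r) * (4 * (a - b) * t / (2 + b * t\<^sup>2)\<^sup>2)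
         / ((2 + a * t\<^sup>2) / (2 + b * t\<^sup>2)) = D2 * t / (2 * D t)" .
      have pos: "(2 + a * t\<^sup>2) / (2 + b * t\<^sup>2) > 0" using elim by simp
      show ?case
        using has_derivative_mult_log[OF rootder[OF elim(1)]
            has_derivative_powr_log[OF q pos, of "D2 / (4 * r)", unfolded e]] elim
        by (simp add: f half)
    qed
  next
    case 4
    have f: "f_fun k1 k2 k3 =
      (\<lambda>s. sqrt (1 + D2 / 2 * s\<^sup>2) * exp (1 / 2 - 1 / (2 + D2 * s\<^sup>2)))"
      using f_eq 4 by auto
    have "\<forall>\<^sub>F t in nhds 0. 1 + D2 / 2 * t\<^sup>2 > 0"
      by (rule eventually_pos_nhds) auto
    with Dpos show ?thesis
    proof eventually_elim
      case (elim t)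
      define m where "m = 1 + D2 / 2 * t\<^sup>2"
      have m: "m > 0" "2 + D2 * t\<^sup>2 = 2 * m" using elim by (auto simp: m_def)
      \<comment> \<open>The discriminant vanishes, so \<open>D\<close> is a perfect square.\<close>
      have sq: "D t = m\<^sup>2"
        using rel 4 by (simp add: D_def m_def algebra_simps power2_eq_square numeral_eq_Suc)
      have s: "((\<lambda>t. sqrt (1 + D2 / 2 * t\<^sup>2)) has_real_derivative
          sqrt (1 + D2 / 2 * t\<^sup>2) * (D2 * t / (2 * (1 + D2 / 2 * t\<^sup>2)))) (at t)"
        by (rule has_derivative_sqrt_log) (use elim in \<open>auto intro!: derivative_eq_intros\<close>)
      have e: "((\<lambda>s. exp (1 / 2 - 1 / (2 + D2 * s\<^sup>2))) has_real_derivative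
          exp (1 / 2 - 1 / (2 + D2 * t\<^sup>2)) * (2 * D2 * t / (2 + D2 * t\<^sup>2)\<^sup>2)) (at t)"
        using m by (auto intro!: derivative_eq_intros simp: power2_eq_square)
      have D3: "D3 = D2\<^sup>2 / 4" using rel 4 by simp
      have "D2 * t / (2 * m) + 2 * D2 * t / (2 * m)\<^sup>2 = (D2 * t * m + D2 * t) / (2 * m\<^sup>2)"
        using m by (simp add: field_simps power2_eq_square)
      also have "D2 * t * m + D2 * t = 2 * (t * (D2 + D3 * t\<^sup>2))"
        by (simp add: m_def D3 field_simps power2_eq_square)
      finally have "D2 * t / (2 * m) + 2 * D2 * t / (2 * m)\<^sup>2 = t * (D2 + D3 * t\<^sup>2) / D t"
        using m by (simp add: sq)
      then show ?case
        using has_derivative_mult_log[OF s e] elim m by (simp add: f flip: m_def)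
    qed
  next
    case 5
    define r where "r = sqrt (- D1)"
    have r: "r > 0" "r\<^sup>2 = 4 * D3 - D2\<^sup>2" using 5 rel by (auto simp: r_def)
    have f: "f_fun k1 k2 k3 = (\<lambda>s. root 4 (D s) *
        exp (D2 / (2 * r) * (arctan ((D2 + 2 * D3 * s\<^sup>2) / r) - arctan (D2 / r))))"
      using f_eq 5 by (auto simp: r_def)
    show ?thesis using Dpos
    proof eventually_elim
      case (elim t)
      let ?X = "D2 + 2 * D3 * t\<^sup>2"
      \<comment> \<open>Completing the square in \<open>4 * D3 * D\<close>, as the derivative of arctan requires.\<close>
      have "r\<^sup>2 + ?X\<^sup>2 = 4 * D3 * D t"
        using r(2) by (simp add: D_def algebra_simps power2_eq_square numeral_eq_Suc)
      moreover have "1 + (?X / r)\<^sup>2 = (r\<^sup>2 + ?X\<^sup>2) / r\<^sup>2"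
        using r(1) by (simp add: field_simps)
      ultimately have X: "1 + (?X / r)\<^sup>2 = 4 * D3 * D t / r\<^sup>2" by simp
      have "((\<lambda>s. D2 / (2 * r) * (arctan ((D2 + 2 * D3 * s\<^sup>2) / r) - arctan (D2 / r)))
          has_real_derivative D2 / (2 * r) * (4 * D3 * t / r * inverse (1 + (?X / r)\<^sup>2))) (at t)"
        using r(1) by (auto intro!: derivative_eq_intros)
      also have "D2 / (2 * r) * (4 * D3 * t / r * inverse (1 + (?X / r)\<^sup>2)) = D2 * t / (2 * D t)"
        unfolding X using r(1) 5 elim by (simp add: field_simps power2_eq_square)
      finally have e: "((\<lambda>s. exp (D2 / (2 * r) * (arctan ((D2 + 2 * D3 * s\<^sup>2) / r) - arctan (D2 / r))))
          has_real_derivative exp (D2 / (2 * r) * (arctan (?X / r) - arctan (D2 / r)))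
            * (D2 * t / (2 * D t))) (at t)"
        by (rule DERIV_chain2[OF DERIV_exp])
      show ?case
        using has_derivative_mult_log[OF rootder[OF elim] e] elim by (simp add: f half)
    qed
  qed
  with Dpos show ?thesis by eventually_elim (simp add: D_def)
qed

section \<open>The linear equation and its Wronskian\<close>

definition lead_poly :: "real \<Rightarrow> real \<Rightarrow> real \<Rightarrow> real" where
  "lead_poly k2 k3 s = 1 + k2 * s\<^sup>2 - k3 * s ^ 4"

definition drift_poly :: "real \<Rightarrow> real \<Rightarrow> real \<Rightarrow> real \<Rightarrow> real" where
  "drift_poly k1 k2 k3 s = s * (k2 - k1 - k3 * s\<^sup>2)"

definition wronskian_factor :: "real \<Rightarrow> real \<Rightarrow> real \<Rightarrow> real \<Rightarrow> real" where
  "wronskian_factor k1 k2 k3 s = sqrt (1 + k1 * s\<^sup>2) * f_fun k1 k2 k3 (s / sqrt (1 + k1 * s\<^sup>2))"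

text \<open>
  This identity says that \<open>1 + k1 s\<^sup>2\<close> solves \<open>- P y'' + Q y' + 2 k1 y = 0\<close>.
\<close>

lemma lead_poly_eq: "lead_poly k2 k3 s = (1 + k1 * s\<^sup>2) + s * drift_poly k1 k2 k3 s"
  by (simp add: lead_poly_def drift_poly_def algebra_simps power2_eq_square numeral_eq_Suc)

text \<open>
  The substitution \<open>t = s / r\<close> with \<open>r = sqrt (1 + k1 s\<^sup>2)\<close> has derivative \<open>1 / r^3\<close> and
  turns the quartic \<open>1 + D2 t\<^sup>2 + D3 t^4\<close> into \<open>P / r^4\<close>; this is how \<open>D2\<close> and \<open>D3\<close>
  arise from \<open>k1\<close>, \<open>k2\<close>, \<open>k3\<close>.  With \<open>r' = r * (k1 s / r\<^sup>2)\<close>, the logarithmic derivatives of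
  the two factors add up to \<open>Q / P\<close> by a polynomial identity.
\<close>

lemma wronskian_factor_ode:
  "\<forall>\<^sub>F s in nhds 0. 1 + k1 * s\<^sup>2 > 0 \<and> lead_poly k2 k3 s > 0 \<and> wronskian_factor k1 k2 k3 s > 0 \<and>
    (wronskian_factor k1 k2 k3 has_real_derivative
       wronskian_factor k1 k2 k3 s * (drift_poly k1 k2 k3 s / lead_poly k2 k3 s)) (at s)"
proof -
  let ?D2 = "Delta2 k1 k2 k3" and ?D3 = "Delta3 k1 k2 k3"
  let ?t = "\<lambda>s. s / sqrt (1 + k1 * s\<^sup>2)"
  have "\<forall>\<^sub>F s in nhds 0. 1 + k1 * s\<^sup>2 > 0"
    by (rule eventually_pos_nhds) auto
  moreover have "\<forall>\<^sub>F s in nhds 0. lead_poly k2 k3 s > 0"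
    unfolding lead_poly_def by (rule eventually_pos_nhds) auto
  moreover have "isCont ?t 0" by (intro continuous_intros) auto
  then have "(?t \<longlongrightarrow> ?t 0) (nhds 0)"
    unfolding continuous_at by (rule tendsto_at_iff_tendsto_nhds[THEN iffD1])
  then have "filterlim ?t (nhds 0) (nhds 0)" by simp
  note filterlim_iff[THEN iffD1, OF this, rule_format, OF f_fun_log_derivative[of k1 k2 k3]]
  ultimately show ?thesis
  proof eventually_elim
    case (elim s)
    define r where "r = sqrt (1 + k1 * s\<^sup>2)"
    define P where "P = lead_poly k2 k3 s"
    have r: "r > 0" "r\<^sup>2 = 1 + k1 * s\<^sup>2" and P: "P > 0" using elim by (auto simp: r_def P_def)
    have r4: "r ^ 4 = (1 + k1 * s\<^sup>2)\<^sup>2" using r(2) power_mult[of r 2 2] by simp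
    have Dt: "1 + ?D2 * (s / r)\<^sup>2 + ?D3 * (s / r) ^ 4 = P / r ^ 4"
    proof -
      have "1 + ?D2 * (s / r)\<^sup>2 + ?D3 * (s / r) ^ 4
          = (r ^ 4 + ?D2 * s\<^sup>2 * r\<^sup>2 + ?D3 * s ^ 4) / r ^ 4"
        using r(1) by (simp add: field_simps power2_eq_square numeral_eq_Suc)
      also have "r ^ 4 + ?D2 * s\<^sup>2 * r\<^sup>2 + ?D3 * s ^ 4 = P"
        unfolding r4 r(2)
        by (simp add: P_def lead_poly_def Delta2_def Delta3_def algebra_simps
            power2_eq_square numeral_eq_Suc)
      finally show ?thesis .
    qed
    have rder: "((\<lambda>s. sqrt (1 + k1 * s\<^sup>2)) has_real_derivative r * (k1 * s / r\<^sup>2)) (at s)"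
    proof -
      have "((\<lambda>s. 1 + k1 * s\<^sup>2) has_real_derivative 2 * (k1 * s)) (at s)"
        by (auto intro!: derivative_eq_intros)
      from has_derivative_sqrt_log[OF this elim(1)] show ?thesis
        unfolding r(2) by (simp only: r_def mult_divide_mult_cancel_left_if) simp
    qed
    have "(?t has_real_derivative (r - s * (r * (k1 * s / r\<^sup>2))) / r\<^sup>2) (at s)"
      using DERIV_divide[OF DERIV_ident rder] r(1)
      by (simp add: r_def power2_eq_square)
    also have "r - s * (r * (k1 * s / r\<^sup>2)) = (r\<^sup>2 - k1 * s\<^sup>2) / r"
      using r(1) by (simp add: field_simps power2_eq_square)
    also have "r\<^sup>2 - k1 * s\<^sup>2 = 1" using r(2) by simp
    also have "1 / r / r\<^sup>2 = 1 / r ^ 3" by (simp add: power2_eq_square power3_eq_cube)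
    finally have tder: "(?t has_real_derivative 1 / r ^ 3) (at s)" .
    have "(f_fun k1 k2 k3 has_real_derivative f_fun k1 k2 k3 (s / r) *
        (s / r * (?D2 + ?D3 * (s / r)\<^sup>2) / (P / r ^ 4))) (at (s / r))"
      using elim(3) unfolding Dt[symmetric] r_def[symmetric] by blast
    then have "((\<lambda>s. f_fun k1 k2 k3 (?t s)) has_real_derivative f_fun k1 k2 k3 (s / r) *
        (s / r * (?D2 + ?D3 * (s / r)\<^sup>2) / (P / r ^ 4)) * (1 / r ^ 3)) (at s)"
      unfolding r_def using tder[unfolded r_def] by (rule DERIV_chain2)
    then have fder: "((\<lambda>s. f_fun k1 k2 k3 (?t s)) has_real_derivative f_fun k1 k2 k3 (?t s) *
        (s / r * (?D2 + ?D3 * (s / r)\<^sup>2) / (P / r ^ 4) * (1 / r ^ 3))) (at s)"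
      by (simp add: r_def mult.assoc)
    have "k1 * s / r\<^sup>2 + s / r * (?D2 + ?D3 * (s / r)\<^sup>2) / (P / r ^ 4) * (1 / r ^ 3)
        = (k1 * s * P + s * (?D2 * r\<^sup>2 + ?D3 * s\<^sup>2)) / (r\<^sup>2 * P)"
      using r(1) P by (simp add: field_simps power2_eq_square numeral_eq_Suc)
    also have "k1 * s * P + s * (?D2 * r\<^sup>2 + ?D3 * s\<^sup>2) = drift_poly k1 k2 k3 s * r\<^sup>2"
      unfolding r(2) by (simp add: P_def lead_poly_def drift_poly_def Delta2_def Delta3_def
          algebra_simps power2_eq_square numeral_eq_Suc)
    finally have "k1 * s / r\<^sup>2 + s / r * (?D2 + ?D3 * (s / r)\<^sup>2) / (P / r ^ 4) * (1 / r ^ 3)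
        = drift_poly k1 k2 k3 s / P" using r(1) by simp
    then show ?case
      using has_derivative_mult_log[OF rder[unfolded r_def] fder] elim
      unfolding wronskian_factor_def[abs_def]
      by (simp add: P_def r_def)
  qed
qed

text \<open>
  Here \<open>p\<close>, \<open>p1\<close>, \<open>p2\<close> stand for \<open>\<phi>\<close>, \<open>\<phi>'\<close>, \<open>\<phi>''\<close> at \<open>s\<close>, and so \<open>p\<^sup>2\<close>,
  \<open>2 * p * p1\<close> and \<open>2 * (p1\<^sup>2 + p * p2)\<close> for \<open>\<phi>\<^sup>2\<close> and its first two derivatives.
\<close>

lemma solution_ode_linearize:
  fixes k1 k2 k3 s p p1 p2 :: real
  shows "2 * (s * (k2 - k3 * s\<^sup>2) * (p * p1 - s * p1\<^sup>2 - s * p * p2)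
             - (p1\<^sup>2 + p * p2) + k1 * p * (p - s * p1))
     = - lead_poly k2 k3 s * (2 * (p1\<^sup>2 + p * p2))
       + drift_poly k1 k2 k3 s * (2 * p * p1) + 2 * k1 * p\<^sup>2"
  by (simp add: lead_poly_def drift_poly_def algebra_simps power2_eq_square numeral_eq_Suc)

text \<open>
  Abel's identity for \<open>- P y'' + Q y' + 2 k1 y = 0\<close>: in the derivative of the Wronskian of
  \<open>1 + k1 s\<^sup>2\<close> and \<open>y\<close>, replacing \<open>y''\<close> by means of the equation leaves a multiple of
  the Wronskian itself.
\<close>

lemma solution_wronskian:
  fixes k1 k2 k3 s y2 :: real and y y1 :: "real \<Rightarrow> real"
  assumes y: "(y has_real_derivative y1 s) (at s)"
    and y1: "(y1 has_real_derivative y2) (at s)"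
    and P: "lead_poly k2 k3 s \<noteq> 0"
    and ode: "- lead_poly k2 k3 s * y2 + drift_poly k1 k2 k3 s * y1 s + 2 * k1 * y s = 0"
  shows "((\<lambda>s. (1 + k1 * s\<^sup>2) * y1 s - 2 * k1 * s * y s) has_real_derivative
     ((1 + k1 * s\<^sup>2) * y1 s - 2 * k1 * s * y s) * (drift_poly k1 k2 k3 s / lead_poly k2 k3 s)) (at s)"
proof -
  let ?P = "lead_poly k2 k3 s" and ?Q = "drift_poly k1 k2 k3 s"
  have "((\<lambda>s. (1 + k1 * s\<^sup>2) * y1 s - 2 * k1 * s * y s) has_real_derivative
     (1 + k1 * s\<^sup>2) * y2 - 2 * k1 * y s) (at s)"
    by (auto intro!: derivative_eq_intros y y1)
  moreover have "(1 + k1 * s\<^sup>2) * y2 - 2 * k1 * y s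
      = ((1 + k1 * s\<^sup>2) * y1 s - 2 * k1 * s * y s) * (?Q / ?P)"
  proof -
    have "?P * ((1 + k1 * s\<^sup>2) * y2 - 2 * k1 * y s)
        = (1 + k1 * s\<^sup>2) * (?P * y2) - ?P * (2 * k1 * y s)" by (simp add: algebra_simps)
    also have "?P * y2 = ?Q * y1 s + 2 * k1 * y s" using ode by simp
    also have "(1 + k1 * s\<^sup>2) * (?Q * y1 s + 2 * k1 * y s) - ?P * (2 * k1 * y s)
       = ((1 + k1 * s\<^sup>2) * y1 s - 2 * k1 * s * y s) * ?Q"
      unfolding lead_poly_eq[of k2 k3 s k1] by (simp add: algebra_simps)
    finally show ?thesis using P by (simp add: nonzero_eq_divide_eq mult.commute)
  qed
  ultimately show ?thesis by simp
qed

text \<open>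
  On the right is the shape in which the integrand arises, as a Wronskian over the square of
  the denominator in the derivative of a quotient of two solutions.
\<close>

lemma integrand_eq:
  assumes "1 + k1 * s\<^sup>2 > 0"
  shows "(1 + k1 * s\<^sup>2) powr (- (3 / 2)) * f_fun k1 k2 k3 (s / sqrt (1 + k1 * s\<^sup>2))
    = wronskian_factor k1 k2 k3 s / (1 + k1 * s\<^sup>2)\<^sup>2"
proof -
  have "(1 + k1 * s\<^sup>2) powr (- (3 / 2)) = (1 + k1 * s\<^sup>2) powr (1 / 2 - 2)" by simp
  also have "\<dots> = sqrt (1 + k1 * s\<^sup>2) / (1 + k1 * s\<^sup>2)\<^sup>2"
    unfolding powr_diff using assms by (simp add: powr_half_sqrt)
  finally show ?thesis by (simp add: wronskian_factor_def)
qed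

section \<open>Smoothness by bootstrapping\<close>

text \<open>
  Only products, sums and constants are needed to generate: inverses such as \<open>1/\<phi>\<close> are
  supplied as generators, so membership never involves a side condition about zeros.
\<close>

inductive_set function_algebra :: "(real \<Rightarrow> real) set \<Rightarrow> (real \<Rightarrow> real) set"
  for G where
  gen: "g \<in> G \<Longrightarrow> g \<in> function_algebra G"
| const: "(\<lambda>_. c) \<in> function_algebra G"
| add: "g \<in> function_algebra G \<Longrightarrow> h \<in> function_algebra G \<Longrightarrow> (\<lambda>x. g x + h x) \<in> function_algebra G"
| mult: "g \<in> function_algebra G \<Longrightarrow> h \<in> function_algebra G \<Longrightarrow> (\<lambda>x. g x * h x) \<in> function_algebra G"

lemma function_algebra_diff:
  assumes "g \<in> function_algebra G" "h \<in> function_algebra G"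
  shows "(\<lambda>x. g x - h x) \<in> function_algebra G"
  using function_algebra.add[OF assms(1) function_algebra.mult[OF function_algebra.const[of "-1"] assms(2)]]
  by simp

lemma function_algebra_power:
  assumes "g \<in> function_algebra G"
  shows "(\<lambda>x. g x ^ n) \<in> function_algebra G"
  by (induction n) (auto intro: function_algebra.intros assms)

lemma function_algebra_derivative:
  assumes gens: "\<And>g. g \<in> G \<Longrightarrow>
      \<exists>h\<in>function_algebra G. \<forall>x\<in>A. (g has_real_derivative h x) (at x)"
    and "g \<in> function_algebra G"
  shows "\<exists>h\<in>function_algebra G. \<forall>x\<in>A. (g has_real_derivative h x) (at x)"
  using assms(2)
proof induction
  case (gen g)
  then show ?case by (rule gens)
next
  case (const c)
  show ?case by (rule bexI[OF _ function_algebra.const[of 0]]) auto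
next
  case (add g h)
  then obtain g' h' where *: "g' \<in> function_algebra G" "h' \<in> function_algebra G"
    "\<forall>x\<in>A. (g has_real_derivative g' x) (at x)" "\<forall>x\<in>A. (h has_real_derivative h' x) (at x)"
    by blast
  then show ?case
    by (intro bexI[OF _ function_algebra.add[OF *(1,2)]]) (auto intro: DERIV_add)
next
  case (mult g h)
  then obtain g' h' where *: "g' \<in> function_algebra G" "h' \<in> function_algebra G"
    "\<forall>x\<in>A. (g has_real_derivative g' x) (at x)" "\<forall>x\<in>A. (h has_real_derivative h' x) (at x)"
    by blast
  have "(\<lambda>x. g' x * h x + h' x * g x) \<in> function_algebra G"
    using * mult by (intro function_algebra.add function_algebra.mult)
  then show ?case using * by (intro bexI) (auto intro: DERIV_mult)
qed

text \<open>
  If the generators have their derivatives in the algebra, then so do all of its elements, and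
  inductively every iterated derivative agrees on \<open>A\<close> with an element of the algebra.  Agreement
  on \<open>A\<close> is enough because \<open>A\<close> is open.
\<close>

lemma smooth_on_open_function_algebra:
  assumes "open A"
    and gens: "\<And>g. g \<in> G \<Longrightarrow>
      \<exists>h\<in>function_algebra G. \<forall>x\<in>A. (g has_real_derivative h x) (at x)"
    and "g \<in> function_algebra G"
  shows "smooth_on_open A g"
proof -
  have step: "\<exists>h\<in>function_algebra G. \<forall>x\<in>A. (u has_real_derivative h x) (at x)"
    if "h0 \<in> function_algebra G" "\<forall>x\<in>A. u x = h0 x" for u h0
  proof -
    obtain h where h: "h \<in> function_algebra G" "\<forall>x\<in>A. (h0 has_real_derivative h x) (at x)"
      using function_algebra_derivative[OF gens \<open>h0 \<in> _\<close>] by blast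
    have "(u has_real_derivative h x) (at x)" if "x \<in> A" for x
      by (rule has_field_derivative_transform_within_open[of h0 _ _ A])
        (use h that \<open>open A\<close> \<open>\<forall>x\<in>A. u x = h0 x\<close> in auto)
    with h(1) show ?thesis by blast
  qed
  have "\<exists>h\<in>function_algebra G. \<forall>x\<in>A. (deriv ^^ n) g x = h x" for n
  proof (induction n)
    case 0
    show ?case using assms(3) by auto
  next
    case (Suc n)
    then obtain h where "h \<in> function_algebra G"
      "\<forall>x\<in>A. ((deriv ^^ n) g has_real_derivative h x) (at x)" using step by blast
    then show ?case by (intro bexI[of _ h]) (auto intro: DERIV_imp_deriv)
  qed
  then show ?thesis
    unfolding smooth_on_open_def real_differentiable_def using step by fast
qed

text \<open>
  Solved for \<open>\<phi>2\<close>, the equation puts the derivative of \<open>\<phi>1\<close> into the algebra generated by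
  \<open>s\<close>, \<open>\<phi>\<close>, \<open>\<phi>1\<close>, \<open>1/\<phi>\<close> and \<open>1/P\<close>; the derivatives of the other generators lie in it
  anyway.
\<close>

lemma smooth_solution:
  fixes \<phi> \<phi>1 \<phi>2 :: "real \<Rightarrow> real"
  assumes "open A"
    and d1: "\<And>s. s \<in> A \<Longrightarrow> (\<phi> has_real_derivative \<phi>1 s) (at s)"
    and d2: "\<And>s. s \<in> A \<Longrightarrow> (\<phi>1 has_real_derivative \<phi>2 s) (at s)"
    and nz: "\<And>s. s \<in> A \<Longrightarrow> \<phi> s \<noteq> 0" "\<And>s. s \<in> A \<Longrightarrow> lead_poly k2 k3 s \<noteq> 0"
    and ode: "\<And>s. s \<in> A \<Longrightarrow>
       - lead_poly k2 k3 s * (2 * ((\<phi>1 s)\<^sup>2 + \<phi> s * \<phi>2 s))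
       + drift_poly k1 k2 k3 s * (2 * \<phi> s * \<phi>1 s) + 2 * k1 * (\<phi> s)\<^sup>2 = 0"
  shows "smooth_on_open A \<phi>"
proof -
  let ?iP = "\<lambda>s. 1 / lead_poly k2 k3 s" and ?i\<phi> = "\<lambda>s. 1 / \<phi> s"
  define G where "G = {\<lambda>s. s, \<phi>, \<phi>1, ?i\<phi>, ?iP}"
  have G: "(\<lambda>s. s) \<in> function_algebra G" "\<phi> \<in> function_algebra G" "\<phi>1 \<in> function_algebra G"
      "?i\<phi> \<in> function_algebra G" "?iP \<in> function_algebra G"
    by (rule function_algebra.gen; simp add: G_def)+
  note closed = function_algebra.add function_algebra.mult function_algebra.const
    function_algebra_diff function_algebra_power G
  define h where "h s = ?i\<phi> s * (?iP s * (drift_poly k1 k2 k3 s * \<phi> s * \<phi>1 s + k1 * (\<phi> s)\<^sup>2)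
      - (\<phi>1 s)\<^sup>2)" for s
  have h: "h \<in> function_algebra G"
    unfolding h_def[abs_def] drift_poly_def by (intro closed)
  have \<phi>2: "\<phi>2 s = h s" if "s \<in> A" for s
    using ode[OF that] nz(1)[OF that] nz(2)[OF that] by (simp add: h_def field_simps)
  have iP: "(\<lambda>s. (0 - (2 * k2 * s - 4 * k3 * s ^ 3)) * (?iP s)\<^sup>2) \<in> function_algebra G"
    by (intro closed)
  have Pder: "(lead_poly k2 k3 has_real_derivative 2 * k2 * s - 4 * k3 * s ^ 3) (at s)" for s
    unfolding lead_poly_def[abs_def] by (auto intro!: derivative_eq_intros)
  have i\<phi>: "(\<lambda>s. 0 - \<phi>1 s * (?i\<phi> s)\<^sup>2) \<in> function_algebra G"
    by (intro closed)
  show ?thesis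
  proof (rule smooth_on_open_function_algebra[OF \<open>open A\<close> _ G(2)])
    fix g assume "g \<in> G"
    then consider "g = (\<lambda>s. s)" | "g = \<phi>" | "g = \<phi>1" | "g = ?i\<phi>" | "g = ?iP"
      by (auto simp: G_def)
    then show "\<exists>h\<in>function_algebra G. \<forall>x\<in>A. (g has_real_derivative h x) (at x)"
    proof cases
      case 1
      then show ?thesis by (intro bexI[OF _ closed(3)[of 1]]) auto
    next
      case 2
      then show ?thesis using d1 G by auto
    next
      case 3
      then show ?thesis using d2 \<phi>2 h by (intro bexI[of _ h]) auto
    next
      case 4
      then show ?thesis using nz(1)
        by (intro bexI[OF _ i\<phi>] ballI) (use DERIV_divide[OF DERIV_const[of 1] d1] in
          \<open>simp add: power2_eq_square\<close>)
    next
      case 5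
      then show ?thesis using nz(2) 
        by (intro bexI[OF _ iP] ballI) (use DERIV_divide[OF DERIV_const[of 1] Pder] in
          \<open>simp add: power2_eq_square\<close>)
    qed
  qed
qed

section \<open>Uniqueness\<close>

lemma zero_derivative_unique:
  fixes u v :: "real \<Rightarrow> real"
  assumes "convex J" "a \<in> J" "x \<in> J" "u a = v a"
    and "\<And>s. s \<in> J \<Longrightarrow> (u has_real_derivative d s) (at s)"
    and "\<And>s. s \<in> J \<Longrightarrow> (v has_real_derivative d s) (at s)"
  shows "u x = v x"
proof -
  have "((\<lambda>s. u s - v s) has_real_derivative 0) (at s within J)" if "s \<in> J" for s
    using DERIV_diff[OF assms(5,6)[OF that]] by (auto intro: has_field_derivative_at_within)
  then obtain c where "\<forall>s\<in>J. u s - v s = c"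
    using has_field_derivative_zero_constant[OF assms(1)] by blast
  with assms(2-4) show ?thesis by (metis diff_self eq_iff_diff_eq_0)
qed

lemma linear_first_order_unique:
  fixes u g h :: "real \<Rightarrow> real"
  assumes "convex J" "a \<in> J" "x \<in> J"
    and u: "\<And>s. s \<in> J \<Longrightarrow> (u has_real_derivative u s * h s) (at s)"
    and g: "\<And>s. s \<in> J \<Longrightarrow> (g has_real_derivative g s * h s) (at s)"
    and nz: "\<And>s. s \<in> J \<Longrightarrow> g s \<noteq> 0"
  shows "u x = u a / g a * g x"
proof -
  have "((\<lambda>s. u s / g s) has_real_derivative 0) (at s)" if "s \<in> J" for s
    using DERIV_divide[OF u[OF that] g[OF that] nz[OF that]] by (simp add: algebra_simps)
  then have "u x / g x = u a / g a"
    using zero_derivative_unique[OF assms(1-3), of "\<lambda>s. u s / g s" "\<lambda>_. u a / g a" "\<lambda>_. 0"] by simp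
  then show ?thesis using nz[OF assms(3)] by (simp add: field_simps)
qed

lemma solution_deriv:
  assumes "is_solution k1 k2 k3 \<epsilon> I \<phi>" "s \<in> I"
  shows "(\<phi> has_real_derivative deriv \<phi> s) (at s)"
    and "(deriv \<phi> has_real_derivative deriv (deriv \<phi>) s) (at s)"
proof -
  have "(deriv ^^ n) \<phi> differentiable (at s)" for n
    using assms by (auto simp: is_solution_def smooth_on_open_def)
  from this[of 0] this[of 1] show "(\<phi> has_real_derivative deriv \<phi> s) (at s)"
    "(deriv \<phi> has_real_derivative deriv (deriv \<phi>) s) (at s)"
    by (auto simp: DERIV_deriv_iff_real_differentiable)
qed

text \<open>
  The Wronskian of \<open>1 + k1 s\<^sup>2\<close> and \<open>\<phi>\<^sup>2\<close> satisfies the same first-order linear equation as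
  the Wronskian factor and is \<open>2 \<epsilon>\<close> at \<open>0\<close>, so it is \<open>2 \<epsilon>\<close> times that factor.  Therefore
  \<open>\<phi>\<^sup>2 / (1 + k1 s\<^sup>2)\<close> and \<open>V\<close> have equal derivatives and equal values at \<open>0\<close>.
\<close>

lemma quotient_integral_representation:
  fixes k1 k2 k3 \<epsilon> :: real
  assumes sol: "is_solution k1 k2 k3 \<epsilon> I \<phi>"
    and J: "convex J" "0 \<in> J" "J \<subseteq> I" "s \<in> J"
    and psi0: "\<And>s. s \<in> J \<Longrightarrow> 1 + k1 * s\<^sup>2 > 0"
    and P: "\<And>s. s \<in> J \<Longrightarrow> lead_poly k2 k3 s > 0"
    and Gpos: "\<And>s. s \<in> J \<Longrightarrow> wronskian_factor k1 k2 k3 s > 0"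
    and Gder: "\<And>s. s \<in> J \<Longrightarrow> (wronskian_factor k1 k2 k3 has_real_derivative
       wronskian_factor k1 k2 k3 s * (drift_poly k1 k2 k3 s / lead_poly k2 k3 s)) (at s)"
    and V: "\<And>s. s \<in> J \<Longrightarrow> (V has_real_derivative
        2 * \<epsilon> * (wronskian_factor k1 k2 k3 s / (1 + k1 * s\<^sup>2)\<^sup>2)) (at s)" "V 0 = 1"
  shows "(\<phi> s)\<^sup>2 = (1 + k1 * s\<^sup>2) * V s"
proof -
  define y1 where "y1 s = 2 * \<phi> s * deriv \<phi> s" for s
  define W where "W s = (1 + k1 * s\<^sup>2) * y1 s - 2 * k1 * s * (\<phi> s)\<^sup>2" for s
  have \<phi>': "(\<phi> has_real_derivative deriv \<phi> s) (at s)"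
    and \<phi>'': "(deriv \<phi> has_real_derivative deriv (deriv \<phi>) s) (at s)" if "s \<in> J" for s
    using solution_deriv[OF sol] J(3) that by blast+
  have y: "((\<lambda>s. (\<phi> s)\<^sup>2) has_real_derivative y1 s) (at s)" if "s \<in> J" for s
    using DERIV_power[OF \<phi>'[OF that], of 2] by (simp add: y1_def ac_simps)
  have y1: "(y1 has_real_derivative 2 * ((deriv \<phi> s)\<^sup>2 + \<phi> s * deriv (deriv \<phi>) s)) (at s)"
    if "s \<in> J" for s
    unfolding y1_def[abs_def]
    by (rule DERIV_cong[OF DERIV_mult[OF DERIV_cmult[OF \<phi>'[OF that]] \<phi>''[OF that]]])
      (simp add: power2_eq_square algebra_simps)
  have ode: "- lead_poly k2 k3 s * (2 * ((deriv \<phi> s)\<^sup>2 + \<phi> s * deriv (deriv \<phi>) s))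
       + drift_poly k1 k2 k3 s * y1 s + 2 * k1 * (\<phi> s)\<^sup>2 = 0" if "s \<in> J" for s
  proof -
    have "s * (k2 - k3 * s\<^sup>2) *
               (\<phi> s * deriv \<phi> s - s * (deriv \<phi> s)\<^sup>2 - s * \<phi> s * deriv (deriv \<phi>) s)
             - ((deriv \<phi> s)\<^sup>2 + \<phi> s * deriv (deriv \<phi>) s)
             + k1 * \<phi> s * (\<phi> s - s * deriv \<phi> s) = 0"
      using sol subsetD[OF J(3) that] unfolding is_solution_def by blast
    then show ?thesis unfolding y1_def solution_ode_linearize[symmetric] by simp
  qed
  have W: "(W has_real_derivative W s * (drift_poly k1 k2 k3 s / lead_poly k2 k3 s)) (at s)"
    if "s \<in> J" for s
    unfolding W_def[abs_def]
    using P[OF that] solution_wronskian[of "\<lambda>s. (\<phi> s)\<^sup>2" y1 s,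
        OF y[OF that] y1[OF that] _ ode[OF that]] by simp
  have init: "\<phi> 0 = 1" "deriv \<phi> 0 = \<epsilon>" using sol by (auto simp: is_solution_def)
  have WG: "W s = 2 * \<epsilon> * wronskian_factor k1 k2 k3 s" if "s \<in> J" for s
  proof -
    have "W s = W 0 / wronskian_factor k1 k2 k3 0 * wronskian_factor k1 k2 k3 s"
      by (rule linear_first_order_unique[OF J(1,2) that W Gder less_imp_neq[OF Gpos, symmetric]])
    then show ?thesis by (simp add: W_def y1_def init wronskian_factor_def f_fun_0)
  qed
  have "((\<lambda>s. (\<phi> s)\<^sup>2 / (1 + k1 * s\<^sup>2)) has_real_derivative
        2 * \<epsilon> * (wronskian_factor k1 k2 k3 s / (1 + k1 * s\<^sup>2)\<^sup>2)) (at s)" if "s \<in> J" for s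
  proof -
    have psi0': "((\<lambda>s. 1 + k1 * s\<^sup>2) has_real_derivative 2 * k1 * s) (at s)"
      by (auto intro!: derivative_eq_intros)
    have "((\<lambda>s. (\<phi> s)\<^sup>2 / (1 + k1 * s\<^sup>2)) has_real_derivative W s / (1 + k1 * s\<^sup>2)\<^sup>2) (at s)"
      by (rule DERIV_cong[OF DERIV_divide[OF y[OF that] psi0']])
        (use psi0[OF that] in \<open>auto simp: W_def power2_eq_square algebra_simps\<close>)
    then show ?thesis by (simp add: WG[OF that])
  qed
  from zero_derivative_unique[OF J(1,2,4) _ this V(1)]
  have "(\<phi> s)\<^sup>2 / (1 + k1 * s\<^sup>2) = V s" by (simp add: init V(2))
  then show ?thesis using psi0[OF J(4)] by (simp add: field_simps)
qed

section \<open>Existence\<close>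

text \<open>
  Reading the uniqueness argument backwards.  Below, \<open>y1\<close> and \<open>y2\<close> are the first two
  derivatives of \<open>y = (1 + k1 s\<^sup>2) V\<close>; in \<open>y2\<close> the two terms with \<open>2 k1 s G / (1 + k1 s\<^sup>2)\<^sup>2\<close>
  cancel.  The derivatives of \<open>\<phi> = sqrt y\<close> are then read off from \<open>y1 = 2 \<phi> \<phi>1\<close> and
  \<open>y2 = 2 (\<phi>1\<^sup>2 + \<phi> \<phi>2)\<close>.
\<close>

lemma variation_of_constants_solution:
  fixes k1 k2 k3 \<epsilon> :: real
  assumes "\<delta> > 0"
    and psi0: "\<And>s. s \<in> {-\<delta><..<\<delta>} \<Longrightarrow> 1 + k1 * s\<^sup>2 > 0"
    and P: "\<And>s. s \<in> {-\<delta><..<\<delta>} \<Longrightarrow> lead_poly k2 k3 s > 0"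
    and Gder: "\<And>s. s \<in> {-\<delta><..<\<delta>} \<Longrightarrow> (wronskian_factor k1 k2 k3 has_real_derivative
       wronskian_factor k1 k2 k3 s * (drift_poly k1 k2 k3 s / lead_poly k2 k3 s)) (at s)"
    and Vder: "\<And>s. s \<in> {-\<delta><..<\<delta>} \<Longrightarrow> (V has_real_derivative
        2 * \<epsilon> * (wronskian_factor k1 k2 k3 s / (1 + k1 * s\<^sup>2)\<^sup>2)) (at s)"
    and V: "\<And>s. s \<in> {-\<delta><..<\<delta>} \<Longrightarrow> V s > 0" "V 0 = 1"
  shows "is_solution k1 k2 k3 \<epsilon> {-\<delta><..<\<delta>} (\<lambda>s. sqrt ((1 + k1 * s\<^sup>2) * V s))"
proof -
  let ?A = "{-\<delta><..<\<delta>}" and ?G = "wronskian_factor k1 k2 k3"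
  let ?P = "lead_poly k2 k3" and ?Q = "drift_poly k1 k2 k3"
  define \<phi> where "\<phi> s = sqrt ((1 + k1 * s\<^sup>2) * V s)" for s
  define y1 where "y1 s = 2 * k1 * s * V s + 2 * \<epsilon> * ?G s / (1 + k1 * s\<^sup>2)" for s
  define y2 where "y2 s = 2 * k1 * V s + 2 * \<epsilon> * ?Q s * ?G s / (?P s * (1 + k1 * s\<^sup>2))" for s
  define \<phi>1 where "\<phi>1 s = y1 s / (2 * \<phi> s)" for s
  define \<phi>2 where "\<phi>2 s = (y2 s / 2 - (\<phi>1 s)\<^sup>2) / \<phi> s" for s
  have pos: "\<phi> s > 0" "(\<phi> s)\<^sup>2 = (1 + k1 * s\<^sup>2) * V s" if "s \<in> ?A" for s
    using psi0[OF that] V(1)[OF that] by (auto simp: \<phi>_def)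
  have psi0': "((\<lambda>s. 1 + k1 * s\<^sup>2) has_real_derivative 2 * k1 * s) (at s)" for s
    by (auto intro!: derivative_eq_intros)
  have lin': "((\<lambda>s. 2 * k1 * s) has_real_derivative 2 * k1) (at s)" for s
    by (auto intro!: derivative_eq_intros)
  have y: "((\<lambda>s. (1 + k1 * s\<^sup>2) * V s) has_real_derivative y1 s) (at s)" if "s \<in> ?A" for s
    by (rule DERIV_cong[OF DERIV_mult[OF psi0' Vder[OF that]]])
      (use psi0[OF that] in \<open>simp add: y1_def power2_eq_square\<close>)
  have y1: "(y1 has_real_derivative y2 s) (at s)" if "s \<in> ?A" for s
  proof -
    define m where "m = 1 + k1 * s\<^sup>2"
    have m: "m > 0" using psi0[OF that] by (simp add: m_def)
    have nz: "1 + k1 * s\<^sup>2 \<noteq> 0" using psi0[OF that] by simp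
    have "(y1 has_real_derivative
        2 * k1 * V s + 2 * \<epsilon> * (?G s / m\<^sup>2) * (2 * k1 * s)
        + (2 * \<epsilon> * (?G s * (?Q s / ?P s)) * m - 2 * \<epsilon> * ?G s * (2 * k1 * s)) / (m * m)) (at s)"
      unfolding y1_def[abs_def] m_def
      by (rule DERIV_add[OF DERIV_mult[OF lin' Vder[OF that]]
            DERIV_divide[OF DERIV_cmult[OF Gder[OF that]] psi0' nz]])
    also have "2 * k1 * V s + 2 * \<epsilon> * (?G s / m\<^sup>2) * (2 * k1 * s)
        + (2 * \<epsilon> * (?G s * (?Q s / ?P s)) * m - 2 * \<epsilon> * ?G s * (2 * k1 * s)) / (m * m) = y2 s"
      using m P[OF that] unfolding y2_def m_def[symmetric]
      by (simp add: field_simps power2_eq_square)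
    finally show ?thesis .
  qed
  have ode: "- ?P s * y2 s + ?Q s * y1 s + 2 * k1 * (\<phi> s)\<^sup>2 = 0" if "s \<in> ?A" for s
  proof -
    define m where "m = 1 + k1 * s\<^sup>2"
    have m: "m > 0" "?P s = m + s * ?Q s"
      using psi0[OF that] lead_poly_eq[of k2 k3 s k1] by (simp_all add: m_def)
    have "?P s * y2 s = 2 * k1 * V s * ?P s + 2 * \<epsilon> * ?Q s * ?G s / m"
      using P[OF that] m(1) unfolding y2_def m_def[symmetric] by (simp add: field_simps)
    then show ?thesis
      unfolding y1_def pos(2)[OF that] m_def[symmetric] m(2) by (simp add: algebra_simps)
  qed
  have d1: "(\<phi> has_real_derivative \<phi>1 s) (at s)" if "s \<in> ?A" for s
    using has_derivative_sqrt_log[OF y[OF that]] pos[OF that] psi0[OF that] V(1)[OF that]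
    unfolding \<phi>_def[symmetric] pos(2)[OF that, symmetric] \<phi>1_def
    by (simp add: power2_eq_square)
  have d2: "(\<phi>1 has_real_derivative \<phi>2 s) (at s)" if "s \<in> ?A" for s
  proof -
    have "(\<phi>1 has_real_derivative (y2 s * (2 * \<phi> s) - y1 s * (2 * \<phi>1 s)) / (2 * \<phi> s * (2 * \<phi> s))) (at s)"
      unfolding \<phi>1_def[abs_def]
      by (rule DERIV_divide[OF y1[OF that]])
        (use DERIV_cmult[OF d1[OF that], of 2] pos(1)[OF that] in \<open>auto simp: \<phi>1_def\<close>)
    moreover have "y1 s = 2 * \<phi> s * \<phi>1 s" using pos(1)[OF that] by (simp add: \<phi>1_def)
    then have "(y2 s * (2 * \<phi> s) - y1 s * (2 * \<phi>1 s)) / (2 * \<phi> s * (2 * \<phi> s)) = \<phi>2 s"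
      using pos(1)[OF that] by (simp add: \<phi>2_def field_simps power2_eq_square)
    ultimately show ?thesis by simp
  qed
  have ode': "- ?P s * (2 * ((\<phi>1 s)\<^sup>2 + \<phi> s * \<phi>2 s))
       + ?Q s * (2 * \<phi> s * \<phi>1 s) + 2 * k1 * (\<phi> s)\<^sup>2 = 0" if "s \<in> ?A" for s
  proof -
    have "2 * ((\<phi>1 s)\<^sup>2 + \<phi> s * \<phi>2 s) = y2 s" "2 * \<phi> s * \<phi>1 s = y1 s"
      using pos(1)[OF that] by (simp_all add: \<phi>2_def \<phi>1_def)
    then show ?thesis using ode[OF that] by simp
  qed
  have smooth: "smooth_on_open ?A \<phi>"
    by (rule smooth_solution[OF _ d1 d2 _ _ ode']) (use pos(1) P in \<open>auto simp: less_le\<close>)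
  have D1: "deriv \<phi> s = \<phi>1 s" if "s \<in> ?A" for s
    using d1[OF that] by (rule DERIV_imp_deriv)
  have D2: "deriv (deriv \<phi>) s = \<phi>2 s" if "s \<in> ?A" for s
    by (rule DERIV_imp_deriv, rule has_field_derivative_transform_within_open[OF d2[OF that], of ?A])
      (use that D1 in auto)
  have "deriv \<phi> 0 = \<epsilon>"
    using D1[of 0] \<open>\<delta> > 0\<close> V(2) by (simp add: \<phi>1_def y1_def \<phi>_def wronskian_factor_def f_fun_0)
  moreover have "\<phi> 0 = 1" by (simp add: \<phi>_def V(2))
  moreover have "s * (k2 - k3 * s\<^sup>2) *
               (\<phi> s * deriv \<phi> s - s * (deriv \<phi> s)\<^sup>2 - s * \<phi> s * deriv (deriv \<phi>) s)
             - ((deriv \<phi> s)\<^sup>2 + \<phi> s * deriv (deriv \<phi>) s)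
             + k1 * \<phi> s * (\<phi> s - s * deriv \<phi> s) = 0" if "s \<in> ?A" for s
    using ode'[OF that] unfolding D1[OF that] D2[OF that] solution_ode_linearize[symmetric] by simp
  ultimately have "is_solution k1 k2 k3 \<epsilon> ?A \<phi>"
    using smooth pos(1) \<open>\<delta> > 0\<close> unfolding is_solution_def
    by (auto simp: is_interval_convex_1)
  then show ?thesis by (simp add: \<phi>_def[abs_def])
qed

section \<open>The solution formula\<close>

theorem theorem4p5:
  fixes k1 k2 k3 \<epsilon> :: real
  assumes "\<epsilon> \<noteq> 0"
  shows "\<exists>\<delta>>0.
           is_solution k1 k2 k3 \<epsilon> {-\<delta><..<\<delta>} (phi_formula k1 k2 k3 \<epsilon>) \<and>
           (\<forall>I \<phi>. is_solution k1 k2 k3 \<epsilon> I \<phi> \<longrightarrow>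
              (\<forall>s \<in> I \<inter> {-\<delta><..<\<delta>}. \<phi> s = phi_formula k1 k2 k3 \<epsilon> s))"
proof -
  let ?G = "wronskian_factor k1 k2 k3"
  define g where "g s = (1 + k1 * s\<^sup>2) powr (- (3 / 2)) * f_fun k1 k2 k3 (s / sqrt (1 + k1 * s\<^sup>2))"
    for s
  define V where "V s = 1 + 2 * \<epsilon> * (LBINT \<sigma>=0..s. g \<sigma>)" for s :: real
  have formula: "phi_formula k1 k2 k3 \<epsilon> = (\<lambda>s. sqrt ((1 + k1 * s\<^sup>2) * V s))"
    by (simp add: phi_formula_def V_def g_def fun_eq_iff)
  obtain \<delta>1 where "\<delta>1 > 0" and
    psi0: "\<And>s. s \<in> {-\<delta>1<..<\<delta>1} \<Longrightarrow> 1 + k1 * s\<^sup>2 > 0" and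
    P: "\<And>s. s \<in> {-\<delta>1<..<\<delta>1} \<Longrightarrow> lead_poly k2 k3 s > 0" and
    Gpos: "\<And>s. s \<in> {-\<delta>1<..<\<delta>1} \<Longrightarrow> ?G s > 0" and
    Gder: "\<And>s. s \<in> {-\<delta>1<..<\<delta>1} \<Longrightarrow> (?G has_real_derivative
       ?G s * (drift_poly k1 k2 k3 s / lead_poly k2 k3 s)) (at s)"
    using eventually_nhds_0_interval[OF wronskian_factor_ode[of k1 k2 k3]] by metis
  \<comment> \<open>Halving the radius gives a compact interval, on which the integrand is continuous and the
    fundamental theorem of calculus applies; it is shrunk once more below to keep \<open>V\<close>
    positive.\<close>
  define \<delta>0 where "\<delta>0 = \<delta>1 / 2"
  have \<delta>0: "\<delta>0 > 0" "{-\<delta>0..\<delta>0} \<subseteq> {-\<delta>1<..<\<delta>1}" using \<open>\<delta>1 > 0\<close> by (auto simp: \<delta>0_def)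
  have g: "g s = ?G s / (1 + k1 * s\<^sup>2)\<^sup>2" if "s \<in> {-\<delta>1<..<\<delta>1}" for s
    unfolding g_def by (rule integrand_eq[OF psi0[OF that]])
  have "continuous_on {-\<delta>1<..<\<delta>1} ?G"
    by (intro continuous_at_imp_continuous_on ballI DERIV_isCont[OF Gder])
  then have "continuous_on {-\<delta>1<..<\<delta>1} (\<lambda>s. ?G s / (1 + k1 * s\<^sup>2)\<^sup>2)"
    using psi0 by (intro continuous_intros) (auto simp: less_le)
  then have "continuous_on {-\<delta>1<..<\<delta>1} g"
    by (rule continuous_on_eq) (simp add: g)
  then have gcont: "continuous_on {-\<delta>0..\<delta>0} g"
    using \<delta>0(2) by (rule continuous_on_subset)
  have Vder: "(V has_real_derivative 2 * \<epsilon> * (?G s / (1 + k1 * s\<^sup>2)\<^sup>2)) (at s)"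
    if "s \<in> {-\<delta>0<..<\<delta>0}" for s
  proof -
    have "((\<lambda>u. LBINT \<sigma>=0..u. g \<sigma>) has_vector_derivative g s) (at s within {-\<delta>0..\<delta>0})"
      using interval_integral_FTC2[OF _ _ gcont, of 0 s] that \<delta>0(1) by (simp add: zero_ereal_def)
    then have "((\<lambda>u. LBINT \<sigma>=0..u. g \<sigma>) has_real_derivative g s) (at s)"
      using that by (simp add: at_within_Icc_at has_real_derivative_iff_has_vector_derivative)
    then have "(V has_real_derivative 2 * \<epsilon> * g s) (at s)"
      unfolding V_def[abs_def] by (auto intro!: derivative_eq_intros)
    moreover have "s \<in> {-\<delta>1<..<\<delta>1}" using that \<delta>0 by (auto simp: \<delta>0_def)
    ultimately show ?thesis by (simp add: g)
  qed
  have V0: "V 0 = 1" by (simp add: V_def zero_ereal_def)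
  have Vpos: "\<forall>\<^sub>F s in nhds 0. V s > 0"
    by (rule eventually_pos_nhds) (use Vder[of 0] \<delta>0(1) V0 in \<open>auto intro: DERIV_isCont\<close>)
  obtain \<delta>2 where \<delta>2: "\<delta>2 > 0" "\<And>s. s \<in> {-\<delta>2<..<\<delta>2} \<Longrightarrow> V s > 0"
    using eventually_nhds_0_interval[OF Vpos] by metis
  define \<delta> where "\<delta> = min \<delta>0 \<delta>2"
  have \<delta>: "\<delta> > 0" using \<delta>0 \<delta>2 by (simp add: \<delta>_def)
  have sub: "s \<in> {-\<delta>1<..<\<delta>1} \<and> s \<in> {-\<delta>0<..<\<delta>0} \<and> s \<in> {-\<delta>2<..<\<delta>2}" if "s \<in> {-\<delta><..<\<delta>}" for s
    using that \<delta>0 by (auto simp: \<delta>_def \<delta>0_def)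
  have sol: "is_solution k1 k2 k3 \<epsilon> {-\<delta><..<\<delta>} (phi_formula k1 k2 k3 \<epsilon>)"
    unfolding formula
    by (rule variation_of_constants_solution[OF \<delta>])
      (use sub psi0 P Gder Vder \<delta>2(2) V0 in blast)+
  have uniq: "\<phi> s = phi_formula k1 k2 k3 \<epsilon> s"
    if *: "is_solution k1 k2 k3 \<epsilon> I \<phi>" "s \<in> I \<inter> {-\<delta><..<\<delta>}" for I \<phi> s
  proof -
    have I: "convex I" "0 \<in> I" "\<phi> s > 0"
      using * by (auto simp: is_solution_def is_interval_convex_1)
    have J: "convex (I \<inter> {-\<delta><..<\<delta>})" "0 \<in> I \<inter> {-\<delta><..<\<delta>}"
      using I \<delta> by (auto intro: convex_Int)
    have "(\<phi> s)\<^sup>2 = (1 + k1 * s\<^sup>2) * V s"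
      by (rule quotient_integral_representation[OF *(1) J Int_lower1 *(2)])
        (use sub psi0 P Gpos Gder Vder V0 in blast)+
    then show ?thesis using I(3) by (simp add: formula flip: real_sqrt_unique)
  qed
  show ?thesis using \<delta> sol uniq by blast
qed

end
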